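(* Let $q$ be a positive integer and let $a = \sum_{k=0}^n 10^k a_k$ be an integer with decimal digits $a_n a_{n-1}\ldots a_1a_0$, $0\le a_k\le 9$, of length $n+1$. Then the binomial test $B_q(a) := \sum_{j=0}^n (10-q)^j a_j$ satisfies $$B_q(a) = (\mathrm{LStack}\circ LT_q)^n(a),$$ where $LT_q$ and $\mathrm{LStack}$ are the left trim and left stack operations defined in the context, and the power $n$ denotes $n$-fold iteration starting from the usual decimal representation of $a$.
   Context: The operations act on decimal-like representations whose leading coefficient may be an arbitrary integer. A representation of the form $(c_m)c_{m-1}\ldots c_1c_0$, with $c_m\in\mathbb{Z}$ arbitrary and $0\le c_k\le 9$ for $0\le k\le m-1$, stands for the integer $\sum_{k=0}^m 10^k c_k$. For example, $(11)184$ stands for $11\cdot 10^3+184$. The usual decimal representation of $a$ is the case $m=n$, $c_k=a_k$. Write $c_{[k,0]} := \sum_{i=0}^{k}10^i c_i$ (which is $0$ if $k<0$). Left trim: for $m\ge 1$, $LT_q$ sends the representation $(c_m)c_{m-1}\ldots c_0$ to the sum $$10^{m-1}(10-q)\,c_m + c_{[m-1,0]} = 10^{m-1}(10-q)\,c_m + 10^{m-1}c_{m-1} + c_{[m-2,0]}.$$ Left stack: $\mathrm{LStack}$ rewrites this sum, without changing its integer value and without carrying, as the representation with one fewer coefficient whose leading coefficient is $(10-q)c_m + c_{m-1}$ and whose remaining digits are $c_{m-2},\ldots,c_0$: $$\mathrm{LStack}\bigl(10^{m-1}(10-q)c_m + 10^{m-1}c_{m-1} + c_{[m-2,0]}\bigr)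 = \bigl((10-q)c_m + c_{m-1}\bigr)c_{m-2}\ldots c_0.$$ Thus $\mathrm{LStack}\circ LT_q$ sends $(c_m)c_{m-1}\ldots c_0$ to $\bigl((10-q)c_m+c_{m-1}\bigr)c_{m-2}\ldots c_0$. After $n$ iterations starting from the decimal representation $a_na_{n-1}\ldots a_0$, the result is a representation with a single coefficient, which is identified with that integer. *)

theory Defs
  imports Main
begin

text \<open>
  \<^term>\<open>Rep c ds\<close> is the formal representation $(c_m) c_{m-1} \ldots c_0$, with
  $m$ the length of \<^term>\<open>ds\<close>, $c$ = $c_m$, and
  \<^term>\<open>ds\<close> = $[c_{m-1}, \ldots, c_0]$ (most significant digit first).
\<close>
datatype rep = Rep int "int list"

text \<open>$c_{[k,0]} = \sum_{i=0}^k 10^i c_i$ for the list $[c_k, \ldots, c_0]$.\<close>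
definition low_part :: "int list \<Rightarrow> int" where
  "low_part ds = (\<Sum>i<length ds. 10 ^ i * rev ds ! i)"

fun valid_rep :: "rep \<Rightarrow> bool" where
  "valid_rep (Rep c ds) \<longleftrightarrow> (\<forall>d\<in>set ds. 0 \<le> d \<and> d \<le> 9)"

fun rep_value :: "rep \<Rightarrow> int" where
  "rep_value (Rep c ds) = 10 ^ length ds * c + low_part ds"

text \<open>
  A left trim yields an unevaluated sum, and left stacking depends on its form and not only on its
  integer value. \<^term>\<open>TrimSum t d ds\<close> is the formal sum
  $10^{m-1} t + 10^{m-1} c_{m-1} + c_{[m-2,0]}$ with $d$ = $c_{m-1}$ and
  \<^term>\<open>ds\<close> = $[c_{m-2}, \ldots, c_0]$, so that $m - 1$ is the length of \<^term>\<open>ds\<close>.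
\<close>
datatype trim_sum = TrimSum int int "int list"

fun trim_sum_value :: "trim_sum \<Rightarrow> int" where
  "trim_sum_value (TrimSum t d ds) =
     10 ^ length ds * t + 10 ^ length ds * d + low_part ds"

text \<open>Left trim is only specified for $m \ge 1$; there is deliberately no equation for $m = 0$.\<close>
fun LT :: "int \<Rightarrow> rep \<Rightarrow> trim_sum" where
  "LT q (Rep c (d # ds)) = TrimSum ((10 - q) * c) d ds"

fun LStack :: "trim_sum \<Rightarrow> rep" where
  "LStack (TrimSum t d ds) = Rep (t + d) ds"

text \<open>The representation $(a_n) a_{n-1} \ldots a_0$ with digit sequence \<^term>\<open>dig k\<close> = $a_k$.\<close>
definition decimal_rep :: "nat \<Rightarrow> (nat \<Rightarrow> int) \<Rightarrow> rep" where
  "decimal_rep n dig = Rep (dig n) (map dig (rev [0..<n]))"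

text \<open>$B_q(a)$ for the integer $a$ with digits \<^term>\<open>dig k\<close> = $a_k$, $k \le n$.\<close>
definition binomial_test :: "int \<Rightarrow> nat \<Rightarrow> (nat \<Rightarrow> int) \<Rightarrow> int" where
  "binomial_test q n dig = (\<Sum>j=0..n. (10 - q) ^ j * dig j)"

lemma low_part_Cons: "low_part (d # ds) = 10 ^ length ds * d + low_part ds"
  by (simp add: low_part_def nth_append)

lemma rep_value_decimal_rep: "rep_value (decimal_rep n dig) = (\<Sum>k=0..n. 10 ^ k * dig k)"
  by (simp add: decimal_rep_def low_part_def rev_map atLeast0AtMost lessThan_Suc_atMost [symmetric])

lemma valid_decimal_rep:
  "\<forall>k\<le>n. 0 \<le> dig k \<and> dig k \<le> 9 \<Longrightarrow> valid_rep (decimal_rep n dig)"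
  by (simp add: decimal_rep_def)

lemma trim_sum_value_LT:
  "ds \<noteq> [] \<Longrightarrow>
    trim_sum_value (LT q (Rep c ds)) = 10 ^ (length ds - 1) * (10 - q) * c + low_part ds"
  by (cases ds) (simp_all add: low_part_Cons)

lemma rep_value_LStack: "rep_value (LStack s) = trim_sum_value s"
  by (cases s) (simp add: algebra_simps)

lemma valid_LStack_LT:
  "valid_rep (Rep c ds) \<Longrightarrow> ds \<noteq> [] \<Longrightarrow> valid_rep ((LStack \<circ> LT q) (Rep c ds))"
  by (cases ds) simp_all

lemma rep_value_example: "rep_value (Rep 11 [1, 8, 4]) = 11 * 10 ^ 3 + 184"
  by (simp add: low_part_Cons) (simp add: low_part_def)

end

theory Submission imports Defs begin

text \<open>
  Trimming and then stacking replaces the two leading coefficients $c_m, c_{m-1}$ by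
  $(10-q) c_m + c_{m-1}$, which is one step of Horner's scheme at the point $10 - q$. Running the
  scheme through all the digits evaluates $\sum_j x^j a_j$ at $x = 10 - q$, and this is the binomial
  test. The leading coefficient may leave the range of a digit after one step, so the induction
  in \<open>funpow_LStack_LT\<close> runs over representations with an arbitrary leading coefficient.
\<close>

lemma funpow_LStack_LT:
  "((LStack \<circ> LT q) ^^ m) (Rep c (map dig (rev [0..<m]))) =
     Rep ((10 - q) ^ m * c + (\<Sum>j<m. (10 - q) ^ j * dig j)) []"
proof (induction m arbitrary: c)
  case 0
  show ?case by simp
next
  case (Suc m)
  have "((LStack \<circ> LT q) ^^ Suc m) (Rep c (map dig (rev [0..<Suc m]))) =
      ((LStack \<circ> LT q) ^^ m) (Rep ((10 - q) * c + dig m) (map dig (rev [0..<m])))"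
    by (simp add: funpow_Suc_right del: funpow.simps)
  also have "\<dots> = Rep ((10 - q) ^ m * ((10 - q) * c + dig m) + (\<Sum>j<m. (10 - q) ^ j * dig j)) []"
    by (rule Suc.IH)
  also have "(10 - q) ^ m * ((10 - q) * c + dig m) + (\<Sum>j<m. (10 - q) ^ j * dig j) =
      (10 - q) ^ Suc m * c + (\<Sum>j<Suc m. (10 - q) ^ j * dig j)"
    by (simp add: distrib_left mult.assoc mult.left_commute)
  finally show ?case .
qed

theorem theorem3:
  fixes q a :: int and n :: nat and dig :: "nat \<Rightarrow> int"
  assumes "q > 0"
    and "\<forall>k\<le>n. 0 \<le> dig k \<and> dig k \<le> 9"
    and "a = (\<Sum>k=0..n. 10 ^ k * dig k)"
  shows "Rep (binomial_test q n dig) [] = ((LStack \<circ> LT q) ^^ n) (decimal_rep n dig)"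
proof -
  have "binomial_test q n dig = (10 - q) ^ n * dig n + (\<Sum>j<n. (10 - q) ^ j * dig j)"
    by (simp add: binomial_test_def atLeast0AtMost lessThan_Suc_atMost [symmetric])
  then show ?thesis
    by (simp only: decimal_rep_def funpow_LStack_LT)
qed

end
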